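(* Let $$\underline{f(Y_x=y)}=\min_{f\in\widetilde{\mathcal F}}\Big\{f(y,X=x)+\sum_{i=1}^d\frac{\theta_i\omega_i}{\psi_i}\Big\}$$ (equivalently, the minimum over $\phi=(\theta,\psi,\omega)\in IR_\Phi$), and let $\Phi_{opt}\subseteq IR_\Phi$ be the set of its optimal solutions $\phi$. Then $\underline{f(Y_x=y)}$ is a lower bound of $f(Y_x=y)$. Moreover this bound is tight (i.e. it equals $\min_{f\in\mathcal F}\{f(y,X=x)+\sum_{i=1}^d f(y,u_i,X=x)f(u_i,X\ne x)/f(u_i,X=x)\}$) if and only if $$\{f(y,U,W,X)\in\mathcal F:\ f(y,U,W,X)\text{ is compatible with some }\phi_{opt}\in\Phi_{opt}\}\ne\emptyset.$$ Symmetrically, the same holds for the upper bound $\overline{f(Y_x=y)}$ defined by the corresponding maximization problem and its set of optimal solutions.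
   Context: $W,U,X$ are discrete; $U$ takes values $u_1,\dots,u_d$ ($d<\infty$, $U$ latent), $W$ takes $\dim(W)$ values; $Y$ is discrete or continuous. $f$ denotes probability mass (density in $y$). Fix values $x$ and $y$. The distribution of $(Y,W,X)$ is observed; in particular the column vectors $f(y,W,X=x)$, $f(W,X=x)$, $f(W,X\ne x)\in\mathbb R^{\dim(W)}$ and the numbers $f(y,X=x)$, $f(X=x)$, $f(X\ne x)$. $W$ is a proxy of $U$: given $U$, $W$ is independent of $(X,Y)$. $P(W\mid U)$ is the $\dim(W)\times d$ matrix with columns $f(W\mid u_i)$. Known matrices $\underline P,\overline P$ are given; it is assumed that $P(W\mid U)\in\mathscr P=\{P:\underline P\le P\le\overline P\text{ entrywise}\}$ (partial observability). $\mathcal F$: the set of joint distributions $f(y,U,W,X)$ of $(Y,W,U,X)$ for which $W$ is independent of $(X,Y)$ given $U$, $P(W\mid U)\in\mathscr P$, the $(Y,W,X)$-marginal is the observed one, and $f(u_i,X=x)>0$ for all $i$. The true distribution belongs to $\mathcal F$, and the causal quantity is, by the back-door formula evaluated at the true distribution, $f(Y_x=y)=f(y,X=x)+\sum_{i=1}^d f(y,u_i,X=x)f(u_i,X\ne x)/f(u_i,X=x)$. For a joint distribution put $\theta_i=f(y,u_i,X=x)$, $\psi_i=f(u_i,X=x)$, $\omega_i=f(u_i,X\ne x)$, $\phi=(\theta,\psi,\omega)$; the distribution is "compatible with" $\phi$ if this is its associated $\phi$. $IR_\Phi$ is the set of $\phi$ such that (entrywise) $\underline P\theta\le f(y,W,X=x)\le\overline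 P\theta$, $\underline P\psi\le f(W,X=x)\le\overline P\psi$, $\underline P\omega\le f(W,X\ne x)\le\overline P\omega$; $\sum_i\theta_i=f(y,X=x)$, $\sum_i\psi_i=f(X=x)$, $\sum_i\omega_i=f(X\ne x)$; and for all $i$: $\theta_i\in[0,f(y,X=x)]$, $\psi_i\in(0,f(X=x)]$, $\omega_i\in[0,f(X\ne x)]$. $\widetilde{\mathcal F}$: the set of $f(y,U,W,X)$ whose associated $\phi$ lies in $IR_\Phi$. The minima and maxima are understood to be attained.
   Formalization: The parenthetical equivalence of optimizing over F-tilde and over IR_Phi is claimed only when y has reference measure zero (continuous Y); it fails for discrete Y since IR_Phi omits theta_i <= psi_i. The bound and tightness claims are proved for both versions. *)

theory Defs
  imports "HOL-Probability.Probability"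
begin

text \<open>
  A distribution of a pair \<open>(Y, A)\<close> with \<open>A\<close> discrete is given by a density
  \<open>f :: 'y \<Rightarrow> 'a \<Rightarrow> real\<close> with respect to \<open>\<nu> \<Otimes> counting measure\<close>; the discrete component is
  \<open>(U, W, X)\<close> for a full joint distribution and \<open>(W, X)\<close> for an observed one.
  Discrete \<open>Y\<close> is the case \<open>\<nu> = count_space C\<close> with \<open>C\<close> countable, continuous \<open>Y\<close> is the case
  \<open>\<nu> = lborel\<close>. Since density values at one fixed point \<open>y\<close> are used, densities are functions
  rather than almost-everywhere classes, and identities between them hold at every point of
  \<open>space \<nu>\<close>.
\<close>

definition law :: "'y measure \<Rightarrow> ('y \<Rightarrow> 'a \<Rightarrow> real) \<Rightarrow> ('y \<times> 'a) measure" where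
  "law \<nu> f = density (\<nu> \<Otimes>\<^sub>M count_space UNIV) (\<lambda>(y, a). ennreal (f y a))"

definition distribution :: "'y measure \<Rightarrow> ('y \<Rightarrow> 'a \<Rightarrow> real) \<Rightarrow> bool" where
  "distribution \<nu> f \<longleftrightarrow>
     (\<forall>y\<in>space \<nu>. \<forall>a. 0 \<le> f y a) \<and>
     (\<lambda>(y, a). f y a) \<in> borel_measurable (\<nu> \<Otimes>\<^sub>M count_space UNIV) \<and>
     prob_space (law \<nu> f)"

text \<open>The probability of the event \<open>A \<in> E\<close>.\<close>

definition pr :: "'y measure \<Rightarrow> ('y \<Rightarrow> 'a \<Rightarrow> real) \<Rightarrow> 'a set \<Rightarrow> real" where
  "pr \<nu> f E = measure (law \<nu> f) (space \<nu> \<times> E)"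

type_synonym ('y, 'u, 'w, 'x) joint = "'y \<Rightarrow> 'u \<times> 'w \<times> 'x \<Rightarrow> real"
type_synonym ('y, 'w, 'x) observed = "'y \<Rightarrow> 'w \<times> 'x \<Rightarrow> real"

definition marginal_YWX ::
    "('y, 'u::finite, 'w, 'x) joint \<Rightarrow> ('y, 'w, 'x) observed" where
  "marginal_YWX f = (\<lambda>y (w, x). \<Sum>u\<in>UNIV. f y (u, w, x))"

definition marginal_YUX ::
    "('y, 'u, 'w::finite, 'x) joint \<Rightarrow> 'y \<Rightarrow> 'u \<times> 'x \<Rightarrow> real" where
  "marginal_YUX f = (\<lambda>y (u, x). \<Sum>w\<in>UNIV. f y (u, w, x))"

definition P_WU ::
    "'y measure \<Rightarrow> ('y, 'u::finite, 'w::finite, 'x) joint \<Rightarrow> real^'u^'w" where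
  "P_WU \<nu> f = (\<chi> w u. pr \<nu> f ({u} \<times> {w} \<times> UNIV) / pr \<nu> f ({u} \<times> UNIV \<times> UNIV))"

text \<open>
  \<open>W\<close> is independent of \<open>(X, Y)\<close> given \<open>U\<close>:
  \<open>f(y, w, x | u) = f(w | u) f(y, x | u)\<close> whenever \<open>u\<close> has positive probability.
\<close>

definition proxy ::
    "'y measure \<Rightarrow> ('y, 'u::finite, 'w::finite, 'x) joint \<Rightarrow> bool" where
  "proxy \<nu> f \<longleftrightarrow>
     (\<forall>u. pr \<nu> f ({u} \<times> UNIV \<times> UNIV) > 0 \<longrightarrow>
       (\<forall>y\<in>space \<nu>. \<forall>w x.
          f y (u, w, x) / pr \<nu> f ({u} \<times> UNIV \<times> UNIV) =
          P_WU \<nu> f $ w $ u * (marginal_YUX f y (u, x) / pr \<nu> f ({u} \<times> UNIV \<times> UNIV))))"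

type_synonym 'u params = "(real^'u) \<times> (real^'u) \<times> (real^'u)"

text \<open>
  \<open>f\<close> is compatible with \<open>\<phi>\<close> iff \<open>params \<nu> x y f = \<phi>\<close>.
\<close>

definition params ::
    "'y measure \<Rightarrow> 'x \<Rightarrow> 'y \<Rightarrow> ('y, 'u::finite, 'w::finite, 'x) joint \<Rightarrow> 'u params" where
  "params \<nu> x y f =
     ((\<chi> u. marginal_YUX f y (u, x)),
      (\<chi> u. pr \<nu> f ({u} \<times> UNIV \<times> {x})),
      (\<chi> u. pr \<nu> f ({u} \<times> UNIV \<times> (- {x}))))"

text \<open>
  The inequality \<open>\<le>\<close> on vectors and matrices is entrywise.
\<close>

definition model_F ::
    "'y measure \<Rightarrow> ('y, 'w::finite, 'x) observed \<Rightarrow> real^'u^'w \<Rightarrow> real^'u^'w \<Rightarrow> 'x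
      \<Rightarrow> ('y, 'u::finite, 'w, 'x) joint set" where
  "model_F \<nu> g Plo Pup x =
     {f. distribution \<nu> f \<and> proxy \<nu> f \<and>
         Plo \<le> P_WU \<nu> f \<and> P_WU \<nu> f \<le> Pup \<and>
         (\<forall>y\<in>space \<nu>. marginal_YWX f y = g y) \<and>
         (\<forall>u. pr \<nu> f ({u} \<times> UNIV \<times> {x}) > 0)}"

text \<open>The observed number \<open>f(y, X=x)\<close>.\<close>

definition obs_yx :: "('y, 'w::finite, 'x) observed \<Rightarrow> 'x \<Rightarrow> 'y \<Rightarrow> real" where
  "obs_yx g x y = (\<Sum>w\<in>UNIV. g y (w, x))"

definition IR ::
    "'y measure \<Rightarrow> ('y, 'w::finite, 'x) observed \<Rightarrow> real^'u^'w \<Rightarrow> real^'u^'w \<Rightarrow> 'x \<Rightarrow> 'y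
      \<Rightarrow> 'u::finite params set" where
  "IR \<nu> g Plo Pup x y =
     {(\<theta>, \<psi>, \<omega>).
        (let f_yWx = (\<chi> w. g y (w, x));
             f_Wx = (\<chi> w. pr \<nu> g ({w} \<times> {x}));
             f_Wnx = (\<chi> w. pr \<nu> g ({w} \<times> (- {x})));
             f_yx = obs_yx g x y;
             f_x = pr \<nu> g (UNIV \<times> {x});
             f_nx = pr \<nu> g (UNIV \<times> (- {x}))
         in Plo *v \<theta> \<le> f_yWx \<and> f_yWx \<le> Pup *v \<theta> \<and>
            Plo *v \<psi> \<le> f_Wx \<and> f_Wx \<le> Pup *v \<psi> \<and>
            Plo *v \<omega> \<le> f_Wnx \<and> f_Wnx \<le> Pup *v \<omega> \<and>
            (\<Sum>u\<in>UNIV. \<theta> $ u) = f_yx \<and> (\<Sum>u\<in>UNIV. \<psi> $ u) = f_x \<and> (\<Sum>u\<in>UNIV. \<omega> $ u) = f_nx \<and>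
            (\<forall>u. \<theta> $ u \<in> {0..f_yx} \<and> \<psi> $ u \<in> {0<..f_x} \<and> \<omega> $ u \<in> {0..f_nx}))}"

definition model_Ft ::
    "'y measure \<Rightarrow> ('y, 'w::finite, 'x) observed \<Rightarrow> real^'u^'w \<Rightarrow> real^'u^'w \<Rightarrow> 'x \<Rightarrow> 'y
      \<Rightarrow> ('y, 'u::finite, 'w, 'x) joint set" where
  "model_Ft \<nu> g Plo Pup x y = {f. distribution \<nu> f \<and> params \<nu> x y f \<in> IR \<nu> g Plo Pup x y}"

definition objective ::
    "('y, 'w::finite, 'x) observed \<Rightarrow> 'x \<Rightarrow> 'y \<Rightarrow> 'u::finite params \<Rightarrow> real" where
  "objective g x y = (\<lambda>(\<theta>, \<psi>, \<omega>). obs_yx g x y + (\<Sum>u\<in>UNIV. \<theta> $ u * \<omega> $ u / \<psi> $ u))"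

text \<open>
  The back-door formula for \<open>f(Y\<^sub>x = y)\<close>, evaluated at the joint distribution \<open>f\<close>.
\<close>

definition backdoor ::
    "'y measure \<Rightarrow> ('y, 'w::finite, 'x) observed \<Rightarrow> 'x \<Rightarrow> 'y
      \<Rightarrow> ('y, 'u::finite, 'w, 'x) joint \<Rightarrow> real" where
  "backdoor \<nu> g x y f =
     obs_yx g x y +
     (\<Sum>u\<in>UNIV. marginal_YUX f y (u, x) * pr \<nu> f ({u} \<times> UNIV \<times> (- {x}))
                 / pr \<nu> f ({u} \<times> UNIV \<times> {x}))"

definition has_min :: "('b \<Rightarrow> real) \<Rightarrow> 'b set \<Rightarrow> real \<Rightarrow> bool" where
  "has_min h S m \<longleftrightarrow> (\<exists>s\<in>S. h s = m) \<and> (\<forall>s\<in>S. m \<le> h s)"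

definition has_max :: "('b \<Rightarrow> real) \<Rightarrow> 'b set \<Rightarrow> real \<Rightarrow> bool" where
  "has_max h S m \<longleftrightarrow> (\<exists>s\<in>S. h s = m) \<and> (\<forall>s\<in>S. h s \<le> m)"

end

theory Submission
  imports Defs
begin

text \<open>
  The back-door expression depends on a joint distribution only through its parameters
  \<open>\<phi> = (\<theta>, \<psi>, \<omega>)\<close>, and the linear constraints defining \<open>IR\<close> are necessary for a model
  distribution: by the proxy assumption the observed vectors are mixtures of the columns
  of \<open>P(W | U)\<close>, namely \<open>f(y,W,x) = P \<theta>\<close>, \<open>f(W,x) = P \<psi>\<close> and \<open>f(W,\<noteq>x) = P \<omega>\<close>. Since the weights are
  nonnegative, replacing \<open>P\<close> by its entrywise bounds gives the inequalities of \<open>IR\<close>; the equations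
  for the sums express that the \<open>U\<close>-components add up to the observed marginal (\<open>params_in_IR\<close>).

  Thus optimizing over \<open>IR\<close>, or over the parameters of the distributions in the relaxed model, is
  optimizing the same function over a larger set. The relaxed optimum is therefore a bound, and the
  smaller set attains the same value exactly if it contains a point whose parameters are optimal
  for the larger one (\<open>relaxed_min_attained_iff\<close>; maxima follow by negating the objective).

  The parameters of distributions in the relaxed model form a subset of \<open>IR\<close>. They form all of \<open>IR\<close>
  if \<open>y\<close> is not an atom of \<open>\<nu>\<close>: then the density at \<open>y\<close> can be set to \<open>\<theta>\<close> without affecting the
  probabilities \<open>\<psi>\<close> and \<open>\<omega>\<close>, which together have total mass 1 (\<open>IR_realizable\<close>). At an atom,
  the point mass links \<open>\<theta>\<close> to \<open>\<psi>\<close> through \<open>\<theta>\<^sub>u \<nu>{y} \<le> \<psi>\<^sub>u\<close>, which \<open>IR\<close> does not demand.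
\<close>

section \<open>Optimization over a relaxed feasible set\<close>

text \<open>
  Here \<open>F\<close> is mapped by \<open>p\<close> into the relaxed set \<open>S\<close>, and \<open>b\<close> is the pullback of \<open>h\<close>. An element of
  \<open>F\<close> has value \<open>L\<close> exactly if its image minimizes \<open>h\<close> over \<open>S\<close>, so either such an element exists
  and \<open>b\<close> attains \<open>L\<close>, or \<open>b\<close> stays above \<open>L\<close> everywhere.
\<close>

lemma relaxed_min_attained_iff:
  fixes h :: "'p \<Rightarrow> real"
  assumes "has_min h S L"
    and feasible: "\<And>f. f \<in> F \<Longrightarrow> p f \<in> S"
    and objective: "\<And>f. f \<in> F \<Longrightarrow> b f = h (p f)"
    and "f0 \<in> F"
  shows "L \<le> b f0 \<and>
    (has_min b F L \<longleftrightarrow> {f \<in> F. \<exists>\<phi>\<in>{\<phi>. is_arg_min h (\<lambda>\<phi>. \<phi> \<in> S) \<phi>}. p f = \<phi>} \<noteq> {})"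
proof -
  obtain s where s: "s \<in> S" "h s = L" and low: "\<And>s. s \<in> S \<Longrightarrow> L \<le> h s"
    using assms(1) by (auto simp: has_min_def)
  have bound: "L \<le> b f" if "f \<in> F" for f
    using low[OF feasible[OF that]] objective[OF that] by simp
  have opt: "is_arg_min h (\<lambda>\<phi>. \<phi> \<in> S) (p f) \<longleftrightarrow> b f = L" if "f \<in> F" for f
    using that s low feasible objective by (fastforce simp: is_arg_min_linorder)
  show ?thesis
    using bound opt \<open>f0 \<in> F\<close> unfolding has_min_def by blast
qed

lemma has_max_iff_has_min_uminus: "has_max h S L \<longleftrightarrow> has_min (\<lambda>s. - h s) S (- L)"
  by (simp add: has_max_def has_min_def)

lemma is_arg_max_iff_is_arg_min_uminus:
  fixes h :: "'p \<Rightarrow> real"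
  shows "is_arg_max h P s \<longleftrightarrow> is_arg_min (\<lambda>s. - h s) P s"
  by (simp add: is_arg_max_def is_arg_min_def)

lemma relaxed_max_attained_iff:
  fixes h :: "'p \<Rightarrow> real"
  assumes "has_max h S L"
    and "\<And>f. f \<in> F \<Longrightarrow> p f \<in> S"
    and "\<And>f. f \<in> F \<Longrightarrow> b f = h (p f)"
    and "f0 \<in> F"
  shows "b f0 \<le> L \<and>
    (has_max b F L \<longleftrightarrow> {f \<in> F. \<exists>\<phi>\<in>{\<phi>. is_arg_max h (\<lambda>\<phi>. \<phi> \<in> S) \<phi>}. p f = \<phi>} \<noteq> {})"
  using relaxed_min_attained_iff[of "\<lambda>s. - h s" S "- L" F p "\<lambda>f. - b f" f0] assms
  by (simp add: has_max_iff_has_min_uminus is_arg_max_iff_is_arg_min_uminus)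

section \<open>Event probabilities as sums of point masses\<close>

definition mass :: "'y measure \<Rightarrow> ('y \<Rightarrow> 'a \<Rightarrow> real) \<Rightarrow> 'a \<Rightarrow> ennreal" where
  "mass \<nu> f a = (\<integral>\<^sup>+y. ennreal (f y a) \<partial>\<nu>)"

text \<open>
  Sums over a discrete product restricted to a slice lose the fixed coordinate. Applied once or
  twice, this reduces probabilities of the events \<open>U = u\<close>, \<open>W = w\<close>, \<open>X \<in> A\<close> to sums over \<open>X\<close>.
\<close>

lemma nn_integral_count_space_slice:
  "(\<integral>\<^sup>+p. h p * indicator ({u} \<times> B) p \<partial>count_space UNIV) =
   (\<integral>\<^sup>+b. h (u, b) * indicator B b \<partial>count_space UNIV)"
proof -
  have "(\<integral>\<^sup>+p. h p * indicator ({u} \<times> B) p \<partial>count_space UNIV) =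
    (\<integral>\<^sup>+u'. \<integral>\<^sup>+b. h (u', b) * indicator ({u} \<times> B) (u', b) \<partial>count_space UNIV \<partial>count_space UNIV)"
    by (rule nn_integral_fst_count_space[symmetric])
  also have "\<dots> = (\<Sum>u'\<in>{u}. \<integral>\<^sup>+b. h (u', b) * indicator ({u} \<times> B) (u', b) \<partial>count_space UNIV)"
    by (rule nn_integral_count_space') auto
  also have "\<dots> = (\<integral>\<^sup>+b. h (u, b) * indicator B b \<partial>count_space UNIV)"
    by (auto intro!: nn_integral_cong split: split_indicator)
  finally show ?thesis .
qed

lemma sets_law [measurable_cong]: "sets (law \<nu> f) = sets (\<nu> \<Otimes>\<^sub>M count_space UNIV)"
  by (simp add: law_def)

lemma density_section_measurable:
  assumes "distribution \<nu> f"
  shows "(\<lambda>y. f y a) \<in> borel_measurable \<nu>"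
proof -
  have "(\<lambda>(y, a). f y a) \<in> borel_measurable (\<nu> \<Otimes>\<^sub>M count_space UNIV)"
    using assms by (simp add: distribution_def)
  from measurable_Pair1[OF this, of a] show ?thesis by simp
qed

text \<open>
  By Tonelli's theorem the continuous coordinate can be integrated out first. Afterwards
  every probability needed is a countable sum of masses, and pointwise identities between
  densities become identities between probabilities.
\<close>

lemma emeasure_law:
  fixes f :: "'y \<Rightarrow> 'a::countable \<Rightarrow> real"
  assumes "sigma_finite_measure \<nu>"
    and meas: "(\<lambda>(y, a). f y a) \<in> borel_measurable (\<nu> \<Otimes>\<^sub>M count_space UNIV)"
  shows "emeasure (law \<nu> f) (space \<nu> \<times> E) = (\<integral>\<^sup>+a. mass \<nu> f a * indicator E a \<partial>count_space UNIV)"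
proof -
  interpret sigma_finite_measure \<nu> by fact
  interpret C: sigma_finite_measure "count_space (UNIV :: 'a set)"
    by (rule sigma_finite_measure_count_space)
  interpret P: pair_sigma_finite \<nu> "count_space (UNIV :: 'a set)" ..
  have [measurable]: "(\<lambda>(y, a). f y a) \<in> borel_measurable (\<nu> \<Otimes>\<^sub>M count_space UNIV)"
    by fact
  have E [measurable]: "space \<nu> \<times> E \<in> sets (\<nu> \<Otimes>\<^sub>M count_space UNIV)"
    by (intro pair_measureI) auto
  have "emeasure (law \<nu> f) (space \<nu> \<times> E) =
      (\<integral>\<^sup>+p. (\<lambda>(y, a). ennreal (f y a)) p * indicator (space \<nu> \<times> E) p \<partial>(\<nu> \<Otimes>\<^sub>M count_space UNIV))"
    unfolding law_def by (rule emeasure_density) measurable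
  also have "\<dots> = (\<integral>\<^sup>+a. \<integral>\<^sup>+y. (\<lambda>(y, a). ennreal (f y a)) (y, a) * indicator (space \<nu> \<times> E) (y, a)
      \<partial>\<nu> \<partial>count_space UNIV)"
    by (rule P.nn_integral_snd[symmetric]) measurable
  also have "\<dots> = (\<integral>\<^sup>+a. mass \<nu> f a * indicator E a \<partial>count_space UNIV)"
  proof (rule nn_integral_cong)
    fix a
    have [measurable]: "(\<lambda>y. f y a) \<in> borel_measurable \<nu>"
      using measurable_Pair1[OF meas, of a] by simp
    have "(\<integral>\<^sup>+y. (\<lambda>(y, a). ennreal (f y a)) (y, a) * indicator (space \<nu> \<times> E) (y, a) \<partial>\<nu>)
        = (\<integral>\<^sup>+y. ennreal (f y a) * indicator E a \<partial>\<nu>)"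
      by (rule nn_integral_cong) (auto split: split_indicator)
    then show "(\<integral>\<^sup>+y. (\<lambda>(y, a). ennreal (f y a)) (y, a) * indicator (space \<nu> \<times> E) (y, a) \<partial>\<nu>)
        = mass \<nu> f a * indicator E a"
      by (simp add: mass_def nn_integral_multc)
  qed
  finally show ?thesis .
qed

lemma pr_nonneg [simp]: "0 \<le> pr \<nu> f E"
  by (simp add: pr_def)

lemma pr_empty [simp]: "pr \<nu> f {} = 0"
  by (simp add: pr_def)

lemma ennreal_pr:
  fixes f :: "'y \<Rightarrow> 'a::countable \<Rightarrow> real"
  assumes "sigma_finite_measure \<nu>" "distribution \<nu> f"
  shows "ennreal (pr \<nu> f E) = (\<integral>\<^sup>+a. mass \<nu> f a * indicator E a \<partial>count_space UNIV)"
proof -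
  interpret prob_space "law \<nu> f" using assms(2) by (simp add: distribution_def)
  show ?thesis
    using assms by (simp add: pr_def emeasure_eq_measure[symmetric] emeasure_law distribution_def)
qed

lemma pr_finite_Union:
  assumes "distribution \<nu> f" "finite I" "disjoint_family_on E I"
  shows "pr \<nu> f (\<Union>i\<in>I. E i) = (\<Sum>i\<in>I. pr \<nu> f (E i))"
proof -
  interpret prob_space "law \<nu> f" using assms(1) by (simp add: distribution_def)
  have "measure (law \<nu> f) (\<Union>i\<in>I. space \<nu> \<times> E i) = (\<Sum>i\<in>I. measure (law \<nu> f) (space \<nu> \<times> E i))"
  proof (rule finite_measure_finite_Union[OF assms(2)])
    show "(\<lambda>i. space \<nu> \<times> E i) ` I \<subseteq> events"
      unfolding sets_law by (intro image_subsetI pair_measureI) auto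
    show "disjoint_family_on (\<lambda>i. space \<nu> \<times> E i) I"
      using assms(3) unfolding disjoint_family_on_def by blast
  qed
  moreover have "space \<nu> \<times> (\<Union>i\<in>I. E i) = (\<Union>i\<in>I. space \<nu> \<times> E i)" by blast
  ultimately show ?thesis
    unfolding pr_def by (simp only:)
qed

lemma pr_mono:
  assumes "distribution \<nu> f" "D \<subseteq> E"
  shows "pr \<nu> f D \<le> pr \<nu> f E"
proof -
  interpret prob_space "law \<nu> f" using assms(1) by (simp add: distribution_def)
  have "space \<nu> \<times> E \<in> events"
    unfolding sets_law by (intro pair_measureI) auto
  then show ?thesis
    unfolding pr_def using assms(2) by (intro finite_measure_mono) auto
qed

lemma pr_UNIV:
  assumes "distribution \<nu> f"
  shows "pr \<nu> f UNIV = 1"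
proof -
  interpret prob_space "law \<nu> f" using assms by (simp add: distribution_def)
  have "space (law \<nu> f) = space \<nu> \<times> UNIV" by (simp add: law_def space_pair_measure)
  then show ?thesis unfolding pr_def using prob_space by simp
qed

lemma mass_sum:
  assumes "distribution \<nu> f"
  shows "(\<integral>\<^sup>+y. ennreal (\<Sum>i\<in>I. f y (k i)) \<partial>\<nu>) = (\<Sum>i\<in>I. mass \<nu> f (k i))"
proof -
  have [measurable]: "(\<lambda>y. f y a) \<in> borel_measurable \<nu>" for a
    by (rule density_section_measurable[OF assms])
  have "(\<integral>\<^sup>+y. ennreal (\<Sum>i\<in>I. f y (k i)) \<partial>\<nu>) = (\<integral>\<^sup>+y. (\<Sum>i\<in>I. ennreal (f y (k i))) \<partial>\<nu>)"
    using assms by (intro nn_integral_cong) (simp add: sum_ennreal distribution_def)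
  also have "\<dots> = (\<Sum>i\<in>I. mass \<nu> f (k i))"
    unfolding mass_def by (rule nn_integral_sum) measurable
  finally show ?thesis .
qed

lemma ennreal_pr_slice:
  fixes f :: "'y \<Rightarrow> 'u::countable \<times> 'b::countable \<Rightarrow> real"
  assumes "sigma_finite_measure \<nu>" "distribution \<nu> f"
  shows "ennreal (pr \<nu> f ({u} \<times> B)) = (\<integral>\<^sup>+b. mass \<nu> f (u, b) * indicator B b \<partial>count_space UNIV)"
  by (simp add: ennreal_pr[OF assms] nn_integral_count_space_slice)

lemma ennreal_pr_slice2:
  fixes f :: "'y \<Rightarrow> 'u::countable \<times> 'w::countable \<times> 'x::countable \<Rightarrow> real"
  assumes "sigma_finite_measure \<nu>" "distribution \<nu> f"
  shows "ennreal (pr \<nu> f ({u} \<times> {w} \<times> A)) =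
    (\<integral>\<^sup>+x. mass \<nu> f (u, w, x) * indicator A x \<partial>count_space UNIV)"
  by (simp add: ennreal_pr_slice[OF assms]
      nn_integral_count_space_slice[of "\<lambda>b. mass \<nu> f (u, b)"])

section \<open>Parameters of a model distribution\<close>

text \<open>
  The marginal condition is an identity of densities at every \<open>y\<close>; integrating it over \<open>y\<close> and
  summing over \<open>B\<close> is the law of total probability for the observed events.
\<close>

lemma pr_marginal:
  fixes f :: "('y, 'u::finite, 'w::countable, 'x::countable) joint"
  assumes "sigma_finite_measure \<nu>" "distribution \<nu> f" "distribution \<nu> g"
    and marg: "\<And>y. y \<in> space \<nu> \<Longrightarrow> marginal_YWX f y = g y"
  shows "pr \<nu> g B = (\<Sum>u\<in>UNIV. pr \<nu> f ({u} \<times> B))"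
proof -
  have mass: "mass \<nu> g b = (\<Sum>u\<in>UNIV. mass \<nu> f (u, b))" for b
  proof -
    have "mass \<nu> g b = (\<integral>\<^sup>+y. ennreal (\<Sum>u\<in>UNIV. f y (u, b)) \<partial>\<nu>)"
      unfolding mass_def
      by (rule nn_integral_cong) (simp add: marg[symmetric] marginal_YWX_def split: prod.split)
    then show ?thesis by (simp add: mass_sum[OF assms(2)])
  qed
  have "ennreal (pr \<nu> g B) =
      (\<integral>\<^sup>+b. (\<Sum>u\<in>UNIV. mass \<nu> f (u, b) * indicator B b) \<partial>count_space UNIV)"
    by (simp only: ennreal_pr[OF assms(1,3)] mass sum_distrib_right)
  also have "\<dots> = (\<Sum>u\<in>UNIV. ennreal (pr \<nu> f ({u} \<times> B)))"
    unfolding ennreal_pr_slice[OF assms(1,2)] by (rule nn_integral_sum) simp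
  also have "\<dots> = ennreal (\<Sum>u\<in>UNIV. pr \<nu> f ({u} \<times> B))"
    by (simp add: sum_ennreal)
  finally show ?thesis by (simp add: sum_nonneg)
qed

lemma pr_sum_middle:
  fixes f :: "('y, 'u, 'w::finite, 'x) joint"
  assumes "distribution \<nu> f"
  shows "pr \<nu> f ({u} \<times> UNIV \<times> A) = (\<Sum>w\<in>UNIV. pr \<nu> f ({u} \<times> {w} \<times> A))"
proof -
  have "{u} \<times> UNIV \<times> A = (\<Union>w\<in>UNIV. {u} \<times> {w} \<times> A)" by auto
  moreover have "disjoint_family_on (\<lambda>w. {u} \<times> {w} \<times> A) UNIV"
    by (auto simp: disjoint_family_on_def)
  ultimately show ?thesis
    using pr_finite_Union[OF assms finite] by metis
qed

lemma proxy_factor: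
  fixes f :: "('y, 'u::finite, 'w::finite, 'x) joint"
  assumes "proxy \<nu> f" "pr \<nu> f ({u} \<times> UNIV \<times> UNIV) > 0" "y \<in> space \<nu>"
  shows "f y (u, w, x) = P_WU \<nu> f $ w $ u * marginal_YUX f y (u, x)"
proof -
  have "f y (u, w, x) / pr \<nu> f ({u} \<times> UNIV \<times> UNIV) =
      P_WU \<nu> f $ w $ u * (marginal_YUX f y (u, x) / pr \<nu> f ({u} \<times> UNIV \<times> UNIV))"
    using assms unfolding proxy_def by blast
  then show ?thesis using assms(2) by (simp add: field_simps)
qed

text \<open>
  Conditional independence holds pointwise in \<open>(y, x)\<close> with a factor \<open>f(w | u)\<close> that does not depend
  on \<open>(y, x)\<close>, so the factor survives integration over \<open>y\<close> and summation over \<open>x \<in> A\<close>.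
\<close>

lemma proxy_factor_pr:
  fixes f :: "('y, 'u::finite, 'w::finite, 'x::countable) joint"
  assumes "sigma_finite_measure \<nu>" "distribution \<nu> f" "proxy \<nu> f"
    and "pr \<nu> f ({u} \<times> UNIV \<times> UNIV) > 0"
  shows "pr \<nu> f ({u} \<times> {w} \<times> A) = P_WU \<nu> f $ w $ u * pr \<nu> f ({u} \<times> UNIV \<times> A)"
proof -
  define P where "P = P_WU \<nu> f $ w $ u"
  have [simp]: "0 \<le> P" by (simp add: P_def P_WU_def)
  have [measurable]: "(\<lambda>y. f y a) \<in> borel_measurable \<nu>" for a
    by (rule density_section_measurable[OF assms(2)])
  have mass: "mass \<nu> f (u, w, x) = ennreal P * (\<Sum>w'\<in>UNIV. mass \<nu> f (u, w', x))" for x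
  proof -
    have "mass \<nu> f (u, w, x) = (\<integral>\<^sup>+y. ennreal P * ennreal (\<Sum>w'\<in>UNIV. f y (u, w', x)) \<partial>\<nu>)"
      unfolding mass_def
      by (rule nn_integral_cong)
        (simp add: proxy_factor[OF assms(3,4)] P_def[symmetric] marginal_YUX_def ennreal_mult')
    also have "\<dots> = ennreal P * (\<integral>\<^sup>+y. ennreal (\<Sum>w'\<in>UNIV. f y (u, w', x)) \<partial>\<nu>)"
      by (rule nn_integral_cmult) measurable
    finally show ?thesis by (simp only: mass_sum[OF assms(2)])
  qed
  have "ennreal (pr \<nu> f ({u} \<times> {w} \<times> A)) =
      (\<integral>\<^sup>+x. ennreal P * (\<Sum>w'\<in>UNIV. mass \<nu> f (u, w', x) * indicator A x) \<partial>count_space UNIV)"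
    unfolding ennreal_pr_slice2[OF assms(1,2)]
    by (rule nn_integral_cong) (subst mass, simp only: sum_distrib_right mult.assoc)
  also have "\<dots> = ennreal P *
      (\<integral>\<^sup>+x. (\<Sum>w'\<in>UNIV. mass \<nu> f (u, w', x) * indicator A x) \<partial>count_space UNIV)"
    by (rule nn_integral_cmult) simp
  also have "\<dots> = ennreal P * (\<Sum>w'\<in>UNIV. ennreal (pr \<nu> f ({u} \<times> {w'} \<times> A)))"
    unfolding ennreal_pr_slice2[OF assms(1,2)]
    by (intro arg_cong2[where f = times] refl nn_integral_sum) simp
  also have "\<dots> = ennreal (P * pr \<nu> f ({u} \<times> UNIV \<times> A))"
    by (simp add: pr_sum_middle[OF assms(2)] sum_ennreal ennreal_mult sum_nonneg)
  finally show ?thesis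
    unfolding P_def[symmetric] by (simp add: ennreal_inj)
qed

lemma mixture_entrywise_bounds:
  fixes Plo P Pup :: "real^'u::finite^'w"
  assumes "Plo \<le> P" "P \<le> Pup" "\<And>u. 0 \<le> v $ u"
  shows "Plo *v v \<le> P *v v" "P *v v \<le> Pup *v v"
  using assms by (auto simp: less_eq_vec_def matrix_vector_mult_def intro!: sum_mono mult_right_mono)

text \<open>
  Positivity of every \<open>f(u, X = x)\<close> makes the conditional independence effective for all \<open>u\<close>, so that
  each observed vector is exactly the \<open>P(W | U)\<close>-mixture of the corresponding parameter vector.
  The vectors \<open>\<psi>\<close> and \<open>\<omega>\<close> are treated together as \<open>\<rho> A\<close>, the cases \<open>A = {x}\<close> and \<open>A = - {x}\<close>.
\<close>

lemma params_in_IR: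
  fixes f :: "('y, 'u::finite, 'w::finite, 'x::countable) joint"
  assumes sf: "sigma_finite_measure \<nu>" and y: "y \<in> space \<nu>" and g: "distribution \<nu> g"
    and f: "f \<in> model_F \<nu> g Plo Pup x"
  shows "params \<nu> x y f \<in> IR \<nu> g Plo Pup x y"
proof -
  define P where "P = P_WU \<nu> f"
  define \<theta> :: "real^'u" where "\<theta> = (\<chi> u. marginal_YUX f y (u, x))"
  define \<rho> :: "'x set \<Rightarrow> real^'u" where "\<rho> = (\<lambda>A. \<chi> u. pr \<nu> f ({u} \<times> UNIV \<times> A))"
  have d: "distribution \<nu> f" and px: "proxy \<nu> f" and lo: "Plo \<le> P" and up: "P \<le> Pup"
    and marg: "\<And>y. y \<in> space \<nu> \<Longrightarrow> marginal_YWX f y = g y"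
    and pos: "\<And>u. pr \<nu> f ({u} \<times> UNIV \<times> {x}) > 0"
    using f by (auto simp: model_F_def P_def)
  have pos': "pr \<nu> f ({u} \<times> UNIV \<times> UNIV) > 0" for u
    by (rule less_le_trans[OF pos[of u] pr_mono[OF d]]) auto
  have \<theta>_nonneg: "0 \<le> \<theta> $ u" for u
    using d y by (auto simp: \<theta>_def marginal_YUX_def distribution_def intro!: sum_nonneg)
  have \<rho>_nonneg: "0 \<le> \<rho> A $ u" for A u by (simp add: \<rho>_def)
  have P\<theta>: "P *v \<theta> = (\<chi> w. g y (w, x))"
    by (simp add: vec_eq_iff matrix_vector_mult_def \<theta>_def P_def
        proxy_factor[OF px pos' y, symmetric] marg[OF y, symmetric] marginal_YWX_def)
  have P\<rho>: "P *v \<rho> A = (\<chi> w. pr \<nu> g ({w} \<times> A))" for A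
    by (simp add: vec_eq_iff matrix_vector_mult_def \<rho>_def P_def
        proxy_factor_pr[OF sf d px pos', symmetric] pr_marginal[OF sf d g marg])
  have sum\<theta>: "(\<Sum>u\<in>UNIV. \<theta> $ u) = obs_yx g x y"
    unfolding \<theta>_def obs_yx_def marg[OF y, symmetric] marginal_YWX_def marginal_YUX_def
    by (simp add: sum.swap[of _ "UNIV :: 'u set"])
  have sum\<rho>: "(\<Sum>u\<in>UNIV. \<rho> A $ u) = pr \<nu> g (UNIV \<times> A)" for A
    by (simp add: \<rho>_def pr_marginal[OF sf d g marg])
  have "\<theta> $ u \<le> obs_yx g x y" "\<rho> A $ u \<le> pr \<nu> g (UNIV \<times> A)" for u A
    unfolding sum\<theta>[symmetric] sum\<rho>[symmetric]
    by (auto intro!: member_le_sum \<theta>_nonneg \<rho>_nonneg)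
  moreover have "\<rho> {x} $ u > 0" for u using pos by (simp add: \<rho>_def)
  moreover have "params \<nu> x y f = (\<theta>, \<rho> {x}, \<rho> (- {x}))"
    by (simp add: params_def \<theta>_def \<rho>_def)
  ultimately show ?thesis
    using mixture_entrywise_bounds[OF lo up, of \<theta>] mixture_entrywise_bounds[OF lo up, of "\<rho> {x}"]
      mixture_entrywise_bounds[OF lo up, of "\<rho> (- {x})"] \<theta>_nonneg \<rho>_nonneg sum\<theta> sum\<rho>
    unfolding IR_def Let_def by (simp add: P\<theta> P\<rho>)
qed

lemma backdoor_eq_objective: "backdoor \<nu> g x y f = objective g x y (params \<nu> x y f)"
  by (simp add: backdoor_def objective_def params_def)

section \<open>Realizing feasible parameters\<close>

text \<open>
  Since membership in the relaxed model restricts only the parameters, \<open>W\<close> may be constant and \<open>Y\<close>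
  independent of \<open>(U, X)\<close> up to the null set \<open>{y}\<close>, where the density is set to \<open>\<theta>\<close>. A probability
  density for \<open>Y\<close> is obtained from the observed distribution by conditioning on \<open>X = x\<close>, an event of
  positive probability because all \<open>\<psi>\<^sub>u\<close> are positive.
\<close>

lemma IR_realizable:
  fixes g :: "('y, 'w::finite, 'x::countable) observed"
    and \<phi> :: "'u::finite params"
  assumes sf: "sigma_finite_measure \<nu>" and g: "distribution \<nu> g"
    and null: "{y} \<in> null_sets \<nu>"
    and "\<phi> \<in> IR \<nu> g Plo Pup x y"
  obtains f :: "('y, 'u, 'w, 'x) joint" where "distribution \<nu> f" "params \<nu> x y f = \<phi>"
proof -
  obtain \<theta> \<psi> \<omega> where \<phi>: "\<phi> = (\<theta>, \<psi>, \<omega>)" by (cases \<phi>)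
  define q where "q = pr \<nu> g (UNIV \<times> {x})"
  have sum\<psi>: "(\<Sum>u\<in>UNIV. \<psi> $ u) = q" and sum\<omega>: "(\<Sum>u\<in>UNIV. \<omega> $ u) = pr \<nu> g (UNIV \<times> - {x})"
    and \<theta>: "\<And>u. 0 \<le> \<theta> $ u" and \<psi>: "\<And>u. 0 < \<psi> $ u" and \<psi>q: "\<And>u. \<psi> $ u \<le> q"
    and \<omega>: "\<And>u. 0 \<le> \<omega> $ u" and \<omega>_le: "\<And>u. \<omega> $ u \<le> pr \<nu> g (UNIV \<times> - {x})"
    using assms(4) by (auto simp: \<phi> IR_def Let_def q_def)
  have \<psi>_nonneg: "0 \<le> \<psi> $ u" for u using \<psi>[of u] by simp
  have "0 < q" using \<psi> \<psi>q less_le_trans by blast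
  have g_meas [measurable]: "(\<lambda>y. g y a) \<in> borel_measurable \<nu>" for a
    by (rule density_section_measurable[OF g])
  have [measurable]: "{y} \<in> sets \<nu>" using null by auto

  have obs_nonneg: "0 \<le> obs_yx g x y'" if "y' \<in> space \<nu>" for y'
    using that g by (auto simp: obs_yx_def distribution_def intro!: sum_nonneg)
  define h where "h y' = obs_yx g x y' / q" for y'
  have obs_meas [measurable]: "obs_yx g x \<in> borel_measurable \<nu>"
    unfolding obs_yx_def by measurable
  have h_meas [measurable]: "h \<in> borel_measurable \<nu>"
    unfolding h_def by measurable
  have h_nonneg: "0 \<le> h y'" if "y' \<in> space \<nu>" for y'
    using obs_nonneg[OF that] \<open>0 < q\<close> by (simp add: h_def)
  have int_h: "(\<integral>\<^sup>+y'. ennreal (h y') \<partial>\<nu>) = 1"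
  proof -
    have "ennreal q = (\<Sum>w\<in>UNIV. ennreal (pr \<nu> g ({w} \<times> {x})))"
    proof -
      have "UNIV \<times> {x} = (\<Union>w\<in>UNIV. {w} \<times> {x})" by auto
      moreover have "disjoint_family_on (\<lambda>w. {w} \<times> {x}) (UNIV :: 'w set)"
        by (auto simp: disjoint_family_on_def)
      ultimately have "q = (\<Sum>w\<in>UNIV. pr \<nu> g ({w} \<times> {x}))"
        unfolding q_def using pr_finite_Union[OF g finite] by metis
      then show ?thesis by (simp add: sum_ennreal)
    qed
    also have "\<dots> = (\<Sum>w\<in>UNIV. mass \<nu> g (w, x))"
      by (simp only: ennreal_pr_slice[OF sf g]) simp
    also have "\<dots> = (\<integral>\<^sup>+y'. ennreal (obs_yx g x y') \<partial>\<nu>)"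
      unfolding obs_yx_def by (simp add: mass_sum[OF g])
    finally have "(\<integral>\<^sup>+y'. ennreal (obs_yx g x y') \<partial>\<nu>) = ennreal q" ..
    moreover have "(\<integral>\<^sup>+y'. ennreal (h y') \<partial>\<nu>) = (\<integral>\<^sup>+y'. ennreal (obs_yx g x y') / ennreal q \<partial>\<nu>)"
      using \<open>0 < q\<close> by (intro nn_integral_cong) (simp add: h_def divide_ennreal obs_nonneg)
    ultimately show ?thesis
      using \<open>0 < q\<close> by (simp add: nn_integral_divide obs_meas divide_ennreal)
  qed

  \<comment> \<open>The mass \<open>\<omega>\<close> of \<open>X \<noteq> x\<close> is put on one value \<open>x1\<close>. If \<open>x\<close> is the only value, then \<open>x1\<close> is
    arbitrary, but \<open>\<omega>\<close> vanishes because it is bounded by the probability of an empty event.\<close>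
  define x1 where "x1 = (SOME x'. x' \<noteq> x)"
  define c where "c u x' = (if x' = x then \<psi> $ u else if x' = x1 then \<omega> $ u else 0)" for u x'
  have c_nonneg: "0 \<le> c u x'" for u x' using \<psi>_nonneg \<omega> by (simp add: c_def)
  have c_x: "(\<integral>\<^sup>+x'. ennreal (c u x') * indicator {x} x' \<partial>count_space UNIV) = ennreal (\<psi> $ u)" for u
    by (simp add: c_def)
  have c_nx: "(\<integral>\<^sup>+x'. ennreal (c u x') * indicator (- {x}) x' \<partial>count_space UNIV) = ennreal (\<omega> $ u)" for u
  proof (cases "\<exists>x'. x' \<noteq> x")
    case True
    then have "x1 \<noteq> x" unfolding x1_def by (rule someI_ex)
    have "(\<integral>\<^sup>+x'. ennreal (c u x') * indicator (- {x}) x' \<partial>count_space UNIV) =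
        (\<Sum>x'\<in>{x1}. ennreal (c u x') * indicator (- {x}) x')"
      by (rule nn_integral_count_space') (auto simp: c_def)
    then show ?thesis using \<open>x1 \<noteq> x\<close> by (simp add: c_def)
  next
    case False
    then have "- {x} = {}" by auto
    then show ?thesis using \<omega>[of u] \<omega>_le[of u] by simp
  qed

  define w0 :: 'w where "w0 = undefined"
  define f :: "('y, 'u, 'w, 'x) joint" where
    "f y' = (\<lambda>(u, w, x'). if w = w0 then
        (if y' = y then (if x' = x then \<theta> $ u else 0) else c u x' * h y') else 0)" for y'
  have f_meas: "(\<lambda>(y, a). f y a) \<in> borel_measurable (\<nu> \<Otimes>\<^sub>M count_space UNIV)"
  proof -
    have "(\<lambda>(a, y'). f y' a) \<in> borel_measurable (count_space UNIV \<Otimes>\<^sub>M \<nu>)"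
    proof (rule measurable_pair_measure_countable1)
      fix a :: "'u \<times> 'w \<times> 'x"
      obtain u w x' where a: "a = (u, w, x')" by (cases a)
      show "(\<lambda>y'. (\<lambda>(a, y'). f y' a) (a, y')) \<in> borel_measurable \<nu>"
        unfolding a f_def by simp
    qed simp
    from measurable_pair_swap[OF this] show ?thesis by simp
  qed
  have f_mass: "mass \<nu> f (u, w, x') = (if w = w0 then ennreal (c u x') else 0)" for u w x'
  proof (cases "w = w0")
    case True
    have "mass \<nu> f (u, w, x') = (\<integral>\<^sup>+y'. ennreal (c u x') * ennreal (h y') \<partial>\<nu>)"
      unfolding mass_def
    proof (rule nn_integral_cong_AE)
      show "AE y' in \<nu>. ennreal (f y' (u, w, x')) = ennreal (c u x') * ennreal (h y')"
        using AE_not_in[OF null]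
        by eventually_elim (simp add: f_def True ennreal_mult' c_nonneg)
    qed
    then show ?thesis using True by (simp add: nn_integral_cmult int_h)
  qed (simp add: mass_def f_def)
  have f_sum: "(\<Sum>w\<in>UNIV. \<integral>\<^sup>+x'. mass \<nu> f (u, w, x') * indicator A x' \<partial>count_space UNIV) =
      (\<integral>\<^sup>+x'. ennreal (c u x') * indicator A x' \<partial>count_space UNIV)" for u A
  proof -
    have "(\<Sum>w\<in>UNIV. \<integral>\<^sup>+x'. mass \<nu> f (u, w, x') * indicator A x' \<partial>count_space UNIV) =
        (\<Sum>w\<in>UNIV. if w = w0 then \<integral>\<^sup>+x'. ennreal (c u x') * indicator A x' \<partial>count_space UNIV else 0)"
      by (intro sum.cong) (auto simp: f_mass)
    then show ?thesis by simp
  qed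

  have "emeasure (law \<nu> f) (space \<nu> \<times> UNIV) = 1"
  proof -
    have split: "(\<integral>\<^sup>+x'. ennreal (c u x') * indicator UNIV x' \<partial>count_space UNIV) =
        ennreal (\<psi> $ u + \<omega> $ u)" for u
    proof -
      have "(\<integral>\<^sup>+x'. ennreal (c u x') * indicator UNIV x' \<partial>count_space UNIV) =
          (\<integral>\<^sup>+x'. ennreal (c u x') * indicator {x} x' + ennreal (c u x') * indicator (- {x}) x'
            \<partial>count_space UNIV)"
        by (rule nn_integral_cong) (simp split: split_indicator)
      also have "\<dots> = ennreal (\<psi> $ u) + ennreal (\<omega> $ u)"
        unfolding c_x[symmetric] c_nx[symmetric] by (rule nn_integral_add) auto
      finally show ?thesis using \<psi>_nonneg \<omega> by simp
    qed
    have "emeasure (law \<nu> f) (space \<nu> \<times> UNIV) = (\<integral>\<^sup>+a. mass \<nu> f a \<partial>count_space UNIV)"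
      by (simp add: emeasure_law[OF sf f_meas])
    also have "\<dots> = (\<Sum>u\<in>UNIV. \<Sum>w\<in>UNIV. \<integral>\<^sup>+x'. mass \<nu> f (u, w, x') * indicator UNIV x' \<partial>count_space UNIV)"
      by (simp add: nn_integral_fst_count_space[symmetric] nn_integral_count_space_finite)
    also have "\<dots> = ennreal (\<Sum>u\<in>UNIV. \<psi> $ u + \<omega> $ u)"
      unfolding f_sum split using \<psi>_nonneg \<omega> by (simp add: sum_ennreal del: ennreal_plus)
    also have "(\<Sum>u\<in>UNIV. \<psi> $ u + \<omega> $ u) = 1"
    proof -
      have "pr \<nu> g (\<Union>A\<in>{{x}, - {x}}. UNIV \<times> A) = (\<Sum>A\<in>{{x}, - {x}}. pr \<nu> g (UNIV \<times> A))"
        by (rule pr_finite_Union[OF g]) (auto simp: disjoint_family_on_def)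
      moreover have "(\<Union>A\<in>{{x}, - {x}}. UNIV \<times> A) = (UNIV :: ('w \<times> 'x) set)" by auto
      moreover have "{x} \<noteq> - {x}" by auto
      ultimately show ?thesis
        by (simp add: sum.distrib sum\<psi> sum\<omega> q_def pr_UNIV[OF g])
    qed
    finally show ?thesis by simp
  qed
  then have "prob_space (law \<nu> f)"
    by (intro prob_spaceI) (simp add: law_def space_pair_measure)
  moreover have "0 \<le> f y' a" if "y' \<in> space \<nu>" for y' a
    using \<theta> c_nonneg h_nonneg[OF that] by (simp add: f_def split: prod.split)
  ultimately have d: "distribution \<nu> f"
    using f_meas by (simp add: distribution_def)

  have f_pr: "ennreal (pr \<nu> f ({u} \<times> UNIV \<times> A)) =
      (\<integral>\<^sup>+x'. ennreal (c u x') * indicator A x' \<partial>count_space UNIV)" for u A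
    by (simp add: pr_sum_middle[OF d] sum_ennreal[symmetric] ennreal_pr_slice2[OF sf d] f_sum)
  have "pr \<nu> f ({u} \<times> UNIV \<times> {x}) = \<psi> $ u" "pr \<nu> f ({u} \<times> UNIV \<times> - {x}) = \<omega> $ u" for u
    using f_pr[of u "{x}"] f_pr[of u "- {x}"] \<psi>_nonneg \<omega> unfolding c_x c_nx by simp_all
  moreover have "marginal_YUX f y (u, x) = \<theta> $ u" for u
    by (simp add: marginal_YUX_def f_def)
  ultimately have "params \<nu> x y f = \<phi>"
    by (simp add: params_def \<phi> vec_eq_iff)
  with d show ?thesis by (rule that)
qed

section \<open>Bounds on the causal quantity\<close>

theorem proposition2:
  fixes \<nu> :: "'y measure"
    and g :: "('y, 'w::finite, 'x::countable) observed"
    and f0 :: "('y, 'u::finite, 'w, 'x) joint"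
    and Plo Pup :: "real^'u^'w"
    and x :: 'x and y :: 'y
    and F Ft :: "('y, 'u, 'w, 'x) joint set"
    and \<Phi> :: "'u params set"
  assumes "sigma_finite_measure \<nu>"
    and "y \<in> space \<nu>"
    and "distribution \<nu> g"
    and "F = model_F \<nu> g Plo Pup x"
    and "Ft = model_Ft \<nu> g Plo Pup x y"
    and "\<Phi> = IR \<nu> g Plo Pup x y"
    and "f0 \<in> F"
  shows
    "(\<forall>L \<Phi>opt.
        has_min (\<lambda>f. objective g x y (params \<nu> x y f)) Ft L \<longrightarrow>
        \<Phi>opt = {\<phi>. is_arg_min (objective g x y) (\<lambda>\<phi>. \<phi> \<in> params \<nu> x y ` Ft) \<phi>} \<longrightarrow>
        L \<le> backdoor \<nu> g x y f0 \<and>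
        (has_min (backdoor \<nu> g x y) F L \<longleftrightarrow>
         {f \<in> F. \<exists>\<phi>\<in>\<Phi>opt. params \<nu> x y f = \<phi>} \<noteq> {})) \<and>
     (\<forall>L \<Phi>opt.
        has_min (objective g x y) \<Phi> L \<longrightarrow>
        \<Phi>opt = {\<phi>. is_arg_min (objective g x y) (\<lambda>\<phi>. \<phi> \<in> \<Phi>) \<phi>} \<longrightarrow>
        L \<le> backdoor \<nu> g x y f0 \<and>
        (has_min (backdoor \<nu> g x y) F L \<longleftrightarrow>
         {f \<in> F. \<exists>\<phi>\<in>\<Phi>opt. params \<nu> x y f = \<phi>} \<noteq> {})) \<and>
     ({y} \<in> null_sets \<nu> \<longrightarrow>
        (\<forall>L. has_min (\<lambda>f. objective g x y (params \<nu> x y f)) Ft L \<longleftrightarrow>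
             has_min (objective g x y) \<Phi> L)) \<and>
     (\<forall>L \<Phi>opt.
        has_max (\<lambda>f. objective g x y (params \<nu> x y f)) Ft L \<longrightarrow>
        \<Phi>opt = {\<phi>. is_arg_max (objective g x y) (\<lambda>\<phi>. \<phi> \<in> params \<nu> x y ` Ft) \<phi>} \<longrightarrow>
        backdoor \<nu> g x y f0 \<le> L \<and>
        (has_max (backdoor \<nu> g x y) F L \<longleftrightarrow>
         {f \<in> F. \<exists>\<phi>\<in>\<Phi>opt. params \<nu> x y f = \<phi>} \<noteq> {})) \<and>
     (\<forall>L \<Phi>opt.
        has_max (objective g x y) \<Phi> L \<longrightarrow>
        \<Phi>opt = {\<phi>. is_arg_max (objective g x y) (\<lambda>\<phi>. \<phi> \<in> \<Phi>) \<phi>} \<longrightarrow>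
        backdoor \<nu> g x y f0 \<le> L \<and>
        (has_max (backdoor \<nu> g x y) F L \<longleftrightarrow>
         {f \<in> F. \<exists>\<phi>\<in>\<Phi>opt. params \<nu> x y f = \<phi>} \<noteq> {})) \<and>
     ({y} \<in> null_sets \<nu> \<longrightarrow>
        (\<forall>L. has_max (\<lambda>f. objective g x y (params \<nu> x y f)) Ft L \<longleftrightarrow>
             has_max (objective g x y) \<Phi> L))"
proof -
  have F_IR: "params \<nu> x y f \<in> \<Phi>" if "f \<in> F" for f
    using params_in_IR[OF assms(1-3)] that assms(4,6) by simp
  have F_Ft: "params \<nu> x y f \<in> params \<nu> x y ` Ft" if "f \<in> F" for f
    using F_IR[OF that] that assms(4-6) by (auto simp: model_F_def model_Ft_def)
  have realizable: "params \<nu> x y ` Ft = \<Phi>" if "{y} \<in> null_sets \<nu>"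
  proof
    show "params \<nu> x y ` Ft \<subseteq> \<Phi>" using assms(5,6) by (auto simp: model_Ft_def)
    show "\<Phi> \<subseteq> params \<nu> x y ` Ft"
    proof
      fix \<phi> assume "\<phi> \<in> \<Phi>"
      then have "\<phi> \<in> IR \<nu> g Plo Pup x y" using assms(6) by simp
      then obtain f :: "('y, 'u, 'w, 'x) joint" where "distribution \<nu> f" "params \<nu> x y f = \<phi>"
        by (rule IR_realizable[OF assms(1,3) \<open>{y} \<in> null_sets \<nu>\<close>])
      with \<open>\<phi> \<in> \<Phi>\<close> show "\<phi> \<in> params \<nu> x y ` Ft"
        using assms(5,6) by (force simp: model_Ft_def)
    qed
  qed
  \<comment> \<open>Optimal solutions are parameters, so optima over distributions are read as optima over
    the set of their parameters.\<close>
  have min_image: "has_min (\<lambda>f. objective g x y (params \<nu> x y f)) Ft L \<longleftrightarrow>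
      has_min (objective g x y) (params \<nu> x y ` Ft) L" for L
    by (auto simp: has_min_def)
  have max_image: "has_max (\<lambda>f. objective g x y (params \<nu> x y f)) Ft L \<longleftrightarrow>
      has_max (objective g x y) (params \<nu> x y ` Ft) L" for L
    by (auto simp: has_max_def)
  have lower: "\<forall>L \<Phi>opt. has_min (objective g x y) S L \<longrightarrow>
      \<Phi>opt = {\<phi>. is_arg_min (objective g x y) (\<lambda>\<phi>. \<phi> \<in> S) \<phi>} \<longrightarrow>
      L \<le> backdoor \<nu> g x y f0 \<and> (has_min (backdoor \<nu> g x y) F L \<longleftrightarrow>
        {f \<in> F. \<exists>\<phi>\<in>\<Phi>opt. params \<nu> x y f = \<phi>} \<noteq> {})"
    if "\<And>f. f \<in> F \<Longrightarrow> params \<nu> x y f \<in> S" for S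
  proof (intro allI impI, hypsubst)
    fix L assume "has_min (objective g x y) S L"
    from relaxed_min_attained_iff[OF this that backdoor_eq_objective assms(7)]
    show "L \<le> backdoor \<nu> g x y f0 \<and> (has_min (backdoor \<nu> g x y) F L \<longleftrightarrow>
      {f \<in> F. \<exists>\<phi>\<in>{\<phi>. is_arg_min (objective g x y) (\<lambda>\<phi>. \<phi> \<in> S) \<phi>}. params \<nu> x y f = \<phi>} \<noteq> {})" .
  qed
  have upper: "\<forall>L \<Phi>opt. has_max (objective g x y) S L \<longrightarrow>
      \<Phi>opt = {\<phi>. is_arg_max (objective g x y) (\<lambda>\<phi>. \<phi> \<in> S) \<phi>} \<longrightarrow>
      backdoor \<nu> g x y f0 \<le> L \<and> (has_max (backdoor \<nu> g x y) F L \<longleftrightarrow>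
        {f \<in> F. \<exists>\<phi>\<in>\<Phi>opt. params \<nu> x y f = \<phi>} \<noteq> {})"
    if "\<And>f. f \<in> F \<Longrightarrow> params \<nu> x y f \<in> S" for S
  proof (intro allI impI, hypsubst)
    fix L assume "has_max (objective g x y) S L"
    from relaxed_max_attained_iff[OF this that backdoor_eq_objective assms(7)]
    show "backdoor \<nu> g x y f0 \<le> L \<and> (has_max (backdoor \<nu> g x y) F L \<longleftrightarrow>
      {f \<in> F. \<exists>\<phi>\<in>{\<phi>. is_arg_max (objective g x y) (\<lambda>\<phi>. \<phi> \<in> S) \<phi>}. params \<nu> x y f = \<phi>} \<noteq> {})" .
  qed
  show ?thesis
    unfolding min_image max_image
    by (intro conjI lower[OF F_Ft] lower[OF F_IR] upper[OF F_Ft] upper[OF F_IR])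
      (simp_all add: realizable)
qed

end
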